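(* Let $L>0$ and let $s\ge 2$ be an integer. The second order explicit SSP Runge--Kutta method SSPRK($s$,2) is not strongly stable for $\frac{d}{dt}u(t)=g(u(t))$, $u(0)=u_0$, for all smooth and semibounded $g$ with $|g|_{\mathrm{Lip}}\le L$; that is, there is a smooth and semibounded $g$ with $|g|_{\mathrm{Lip}}\le L$ for which SSPRK($s$,2) is not strongly stable.
   Context: ODE setting: $\mathcal{H}$ is a real vector space with semi inner product $\langle\cdot,\cdot\rangle$ and induced seminorm $\|\cdot\|$ (e.g. a real Hilbert space such as $\mathbb{R}^2$ with the Euclidean inner product), $g\colon\mathcal{H}\to\mathcal{H}$, and the autonomous ODE is $\frac{d}{dt}u(t)=g(u(t))$, $u(0)=u_0\in\mathcal{H}$. The function $g$ is semibounded if $\langle u,g(u)\rangle\le 0$ for all $u\in\mathcal{H}$. Its Lipschitz seminorm is $|g|_{\mathrm{Lip}}=\sup_{u\ne v}\|g(u)-g(v)\|/\|u-v\|$. Smooth means infinitely differentiable. "For all $g$" refers to all such spaces $\mathcal{H}$ and all such $g$ on them. Strong stability: a one-step method mapping $u_0$ to $u_+$ with step size $\Delta t$ is strongly stable for the ODE with semibounded $g$ if there is $\Delta t_{\max}>0$ (possibly depending on $g$) such that $\|u_+\|^2\le\|u_0\|^2$ for all $u_0\in\mathcal{H}$ and all $\Delta t\in(0,\Delta t_{\max}]$. The method SSPRK($s$,2), $s\ge2$, has Butcher coefficients $a_{ij}=\frac1{s-1}$ for $1\le j<i\le s$ (zero otherwise) and $b_i=\frac1s$. Equivalently, one step from $u_0$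 to $u_+$ is $$u_k=u_{k-1}+\frac{\Delta t}{s-1}g(u_{k-1}),\quad k\in\{1,\dots,s\},\qquad u_+=\frac{s-1}{s}u_s+\frac1s u_0 .$$ *)

theory Defs
  imports "HOL-Analysis.Analysis" "HOL-Analysis.Finite_Function_Topology"
begin

text \<open>
  A semi inner product space is a linear subspace \<open>V\<close> of a real vector space type together with a
  function \<open>ip\<close>; only the values of \<open>ip\<close> on \<open>V\<close> matter.
  The form need not be definite, so the induced \<open>snorm\<close> is in general only a seminorm.
  (The class \<open>real_inner\<close> would force definiteness.)
\<close>

definition semi_inner_product_space ::
    "'a::real_vector set \<Rightarrow> ('a \<Rightarrow> 'a \<Rightarrow> real) \<Rightarrow> bool" where
  "semi_inner_product_space V ip \<longleftrightarrow>
     subspace V \<and>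
     (\<forall>u\<in>V. \<forall>v\<in>V. ip u v = ip v u) \<and>
     (\<forall>u\<in>V. \<forall>v\<in>V. \<forall>w\<in>V. ip (u + v) w = ip u w + ip v w) \<and>
     (\<forall>c. \<forall>u\<in>V. \<forall>v\<in>V. ip (c *\<^sub>R u) v = c * ip u v) \<and>
     (\<forall>u\<in>V. 0 \<le> ip u u)"

definition snorm :: "('a \<Rightarrow> 'a \<Rightarrow> real) \<Rightarrow> 'a \<Rightarrow> real" where
  "snorm ip u = sqrt (ip u u)"

definition semibounded ::
    "'a set \<Rightarrow> ('a \<Rightarrow> 'a \<Rightarrow> real) \<Rightarrow> ('a \<Rightarrow> 'a) \<Rightarrow> bool" where
  "semibounded V ip g \<longleftrightarrow> (\<forall>u\<in>V. ip u (g u) \<le> 0)"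

text \<open>
  The supremum is taken in \<^typ>\<open>ennreal\<close>, so it is \<open>\<infinity>\<close> if \<open>g\<close> is not Lipschitz.
  For distinct \<open>u\<close>, \<open>v\<close> at distance \<open>0\<close>, division in \<^typ>\<open>ennreal\<close> gives \<open>0 / 0 = 0\<close> and
  \<open>c / 0 = \<infinity>\<close> for \<open>c > 0\<close>, so that \<open>lipschitz_seminorm V ip g \<le> L\<close> says
  \<open>snorm (g u - g v) \<le> L * snorm (u - v)\<close> for all \<open>u\<close>, \<open>v\<close>.
\<close>

definition lipschitz_seminorm ::
    "'a::real_vector set \<Rightarrow> ('a \<Rightarrow> 'a \<Rightarrow> real) \<Rightarrow> ('a \<Rightarrow> 'a) \<Rightarrow> ennreal" where
  "lipschitz_seminorm V ip g =
     (SUP (u, v) \<in> {(u, v). u \<in> V \<and> v \<in> V \<and> u \<noteq> v}.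
        ennreal (snorm ip (g u - g v)) / ennreal (snorm ip (u - v)))"

text \<open>
  A \<open>k\<close>-linear map is applied to the list of its \<open>k\<close> arguments.
\<close>

definition bounded_multilinear_on ::
    "'a::real_vector set \<Rightarrow> ('a \<Rightarrow> 'a \<Rightarrow> real) \<Rightarrow> nat \<Rightarrow> ('a list \<Rightarrow> 'a) \<Rightarrow> bool" where
  "bounded_multilinear_on V ip k M \<longleftrightarrow>
     (\<forall>vs. set vs \<subseteq> V \<and> length vs = k \<longrightarrow> M vs \<in> V) \<and>
     (\<forall>us vs. set us \<subseteq> V \<and> set vs \<subseteq> V \<and> length us + length vs + 1 = k \<longrightarrow>
        (\<forall>x\<in>V. \<forall>y\<in>V. \<forall>a b.
           M (us @ (a *\<^sub>R x + b *\<^sub>R y) # vs) = a *\<^sub>R M (us @ x # vs) + b *\<^sub>R M (us @ y # vs))) \<and>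
     (\<exists>C. \<forall>vs. set vs \<subseteq> V \<and> length vs = k \<longrightarrow>
        snorm ip (M vs) \<le> C * (\<Prod>v\<leftarrow>vs. snorm ip v))"

text \<open>
  Infinite Frechet differentiability with respect to the seminorm: \<open>D k x\<close> is the \<open>k\<close>-th derivative
  of \<open>g\<close> at \<open>x\<close>, a bounded \<open>k\<close>-linear map, and \<open>D (Suc k) x\<close> is the Frechet derivative at \<open>x\<close> of
  \<open>D k\<close>, where \<open>k\<close>-linear maps carry the operator seminorm; this is why \<open>\<delta>\<close> is independent of \<open>vs\<close>.
  The library's \<open>has_derivative\<close> requires a norm given by a type class and cannot be iterated
  without leaving the type.
\<close>

definition smooth ::
    "'a::real_vector set \<Rightarrow> ('a \<Rightarrow> 'a \<Rightarrow> real) \<Rightarrow> ('a \<Rightarrow> 'a) \<Rightarrow> bool" where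
  "smooth V ip g \<longleftrightarrow>
     (\<exists>D :: nat \<Rightarrow> 'a \<Rightarrow> 'a list \<Rightarrow> 'a.
        (\<forall>x\<in>V. D 0 x [] = g x) \<and>
        (\<forall>k. \<forall>x\<in>V. bounded_multilinear_on V ip k (D k x)) \<and>
        (\<forall>k. \<forall>x\<in>V. \<forall>\<epsilon>>0. \<exists>\<delta>>0. \<forall>h\<in>V. snorm ip h < \<delta> \<longrightarrow>
           (\<forall>vs. set vs \<subseteq> V \<and> length vs = k \<longrightarrow>
              snorm ip (D k (x + h) vs - D k x vs - D (Suc k) x (h # vs))
                \<le> \<epsilon> * snorm ip h * (\<Prod>v\<leftarrow>vs. snorm ip v))))"

text \<open>
  A one-step method, already applied to a right-hand side, is the map taking the step size
  and \<open>u\<^sub>0\<close> to \<open>u\<^sub>+\<close>.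
\<close>

definition strongly_stable ::
    "'a set \<Rightarrow> ('a \<Rightarrow> 'a \<Rightarrow> real) \<Rightarrow> (real \<Rightarrow> 'a \<Rightarrow> 'a) \<Rightarrow> bool" where
  "strongly_stable V ip step \<longleftrightarrow>
     (\<exists>dt_max>0. \<forall>u0\<in>V. \<forall>dt\<in>{0<..dt_max}. (snorm ip (step dt u0))\<^sup>2 \<le> (snorm ip u0)\<^sup>2)"

primrec ssprk2_stage ::
    "nat \<Rightarrow> ('a::real_vector \<Rightarrow> 'a) \<Rightarrow> real \<Rightarrow> 'a \<Rightarrow> nat \<Rightarrow> 'a" where
  "ssprk2_stage s g dt u0 0 = u0"
| "ssprk2_stage s g dt u0 (Suc k) =
     ssprk2_stage s g dt u0 k + (dt / (real s - 1)) *\<^sub>R g (ssprk2_stage s g dt u0 k)"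

definition ssprk2 :: "nat \<Rightarrow> ('a::real_vector \<Rightarrow> 'a) \<Rightarrow> real \<Rightarrow> 'a \<Rightarrow> 'a" where
  "ssprk2 s g dt u0 =
     ((real s - 1) / real s) *\<^sub>R ssprk2_stage s g dt u0 s + (1 / real s) *\<^sub>R u0"

text \<open>
  The same method in Butcher form: \<open>ssprk2_stage s g dt u0 (i - 1)\<close> is the \<open>i\<close>-th Runge--Kutta stage
  for \<open>a\<^sub>i\<^sub>j = 1 / (s - 1)\<close>, \<open>j < i\<close>, and the weights are \<open>b\<^sub>i = 1 / s\<close>.
\<close>

lemma ssprk2_stage_butcher:
  "ssprk2_stage s g dt u0 i =
     u0 + dt *\<^sub>R (\<Sum>j<i. (1 / (real s - 1)) *\<^sub>R g (ssprk2_stage s g dt u0 j))"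
  by (induction i) (simp_all add: scaleR_add_right)

lemma ssprk2_butcher:
  assumes "s \<ge> 2"
  shows "ssprk2 s g dt u0 = u0 + dt *\<^sub>R (\<Sum>i<s. (1 / real s) *\<^sub>R g (ssprk2_stage s g dt u0 i))"
proof -
  have s: "real s \<noteq> 0" "real s - 1 \<noteq> 0" using assms by auto
  define G where "G = (\<Sum>i<s. g (ssprk2_stage s g dt u0 i))"
  have "ssprk2_stage s g dt u0 s = u0 + (dt / (real s - 1)) *\<^sub>R G"
    using ssprk2_stage_butcher[of s g dt u0 s] by (simp add: G_def flip: scaleR_right.sum)
  then have "ssprk2 s g dt u0 =
      ((real s - 1) / real s + 1 / real s) *\<^sub>R u0 + ((real s - 1) / real s * (dt / (real s - 1))) *\<^sub>R G"
    by (simp only: ssprk2_def scaleR_add_right scaleR_add_left scaleR_scaleR ac_simps)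
  also have "\<dots> = u0 + (dt / real s) *\<^sub>R G"
    using s by (simp add: field_simps flip: add_divide_distrib)
  finally show ?thesis
    by (simp add: G_def flip: scaleR_right.sum)
qed

text \<open>
  HOL cannot quantify existentially over types, so a space \<open>\<H>\<close> is chosen as a subspace of one
  fixed large vector space: the free real vector space on continuum many generators, which has
  an isomorphic copy of every real vector space of Hamel dimension at most the continuum.
\<close>

type_synonym universe = "real \<Rightarrow>\<^sub>0 real"

end

theory Submission
  imports Defs
begin

text \<open>
  A linear counterexample in the Euclidean plane suffices: identify the plane with \<open>\<complex>\<close> and let
  \<open>g\<close> be multiplication by \<open>\<i> L\<close>, a quarter turn scaled by \<open>L\<close>.  It is skew, hence semibounded, and
  has Lipschitz seminorm \<open>L\<close>; being bounded and linear it is smooth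
  (\<open>bounded_linear_imp_smooth\<close>).

  For linear \<open>g\<close> a step multiplies \<open>u\<^sub>0\<close> by the value of the stability polynomial, here
  \<open>R = ((s - 1) w + 1) / s\<close> with \<open>w = (1 + \<i> x)^s\<close> and \<open>x = dt L / (s - 1)\<close>.  The exact flow is a
  rotation and preserves the norm, so the truncation error alone decides between growth and decay,
  and for every small step it gives \<open>|R| > 1\<close> (\<open>norm_stability_polynomial_gt_1\<close>).  Indeed,
  \<open>s\<^sup>2 (|R|\<^sup>2 - 1) = (s - 1) ((s - 1) (|w|\<^sup>2 - 1) + 2 (Re w - 1))\<close>.
  Here \<open>|w|\<^sup>2 = (1 + x\<^sup>2)^s > 1 + s x\<^sup>2\<close>, while \<open>Re w \<ge> 1 - s (s - 1) / 2 x\<^sup>2\<close> for small \<open>x\<close>.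
  The terms in \<open>x\<^sup>2\<close> cancel, because the method is of second order, and what remains is positive.
\<close>

section \<open>The stability polynomial on the imaginary axis\<close>

text \<open>
  The four bounds support each other in the induction: a nonnegative imaginary part makes the real
  part decrease from 1, a real part of at most 1 makes the imaginary part grow by at most
  \<open>x\<close> per factor, and this in turn limits the decrease of the real part, which therefore
  stays nonnegative up to the exponent \<open>s\<close>.
\<close>

lemma one_plus_imaginary_power_bounds:
  fixes x :: real
  assumes x: "0 \<le> x" and small: "real s * (real s - 1) / 2 * x\<^sup>2 \<le> 1" and "n \<le> s"
  defines "w \<equiv> \<lambda>n. (1 + \<i> * of_real x) ^ n"
  shows "0 \<le> Im (w n) \<and> Im (w n) \<le> real n * x \<and>
         1 - real n * (real n - 1) / 2 * x\<^sup>2 \<le> Re (w n) \<and> Re (w n) \<le> 1"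
  using \<open>n \<le> s\<close>
proof (induction n)
  case 0
  then show ?case by (simp add: w_def)
next
  case (Suc n)
  then have IH: "0 \<le> Im (w n)" "Im (w n) \<le> real n * x"
      "1 - real n * (real n - 1) / 2 * x\<^sup>2 \<le> Re (w n)" "Re (w n) \<le> 1"
    by auto
  have Re_Suc: "Re (w (Suc n)) = Re (w n) - x * Im (w n)"
    and Im_Suc: "Im (w (Suc n)) = Im (w n) + x * Re (w n)"
    by (simp_all add: w_def)
  have "real n * (real n - 1) \<le> real s * (real s - 1)"
  proof (cases n)
    case (Suc m)
    then show ?thesis using \<open>Suc n \<le> s\<close> by (intro mult_mono) auto
  qed (use \<open>Suc n \<le> s\<close> in simp)
  then have "real n * (real n - 1) / 2 * x\<^sup>2 \<le> real s * (real s - 1) / 2 * x\<^sup>2"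
    by (intro mult_right_mono divide_right_mono) auto
  then have Re_nonneg: "0 \<le> Re (w n)"
    using IH(3) small by linarith
  have "0 \<le> x * Re (w n)" "x * Re (w n) \<le> x"
    using x Re_nonneg IH(4) by (auto simp: mult_left_le)
  moreover have "0 \<le> x * Im (w n)" "x * Im (w n) \<le> real n * x\<^sup>2"
    using x IH(1) mult_left_mono[OF IH(2) x] by (auto simp: power2_eq_square mult_ac)
  moreover have "real (Suc n) * (real (Suc n) - 1) / 2 * x\<^sup>2 =
      real n * (real n - 1) / 2 * x\<^sup>2 + real n * x\<^sup>2"
    by (simp add: field_simps)
  moreover have "real (Suc n) * x = real n * x + x"
    by (simp add: algebra_simps)
  ultimately show ?case
    unfolding Re_Suc Im_Suc using IH by (intro conjI; linarith)
qed

lemma norm_stability_polynomial_gt_1: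
  fixes x :: real
  assumes s: "s \<ge> 2" and x: "x > 0" and small: "real s * (real s - 1) / 2 * x\<^sup>2 \<le> 1"
  shows "norm (of_real ((real s - 1) / real s) * (1 + \<i> * of_real x) ^ s + of_real (1 / real s)) > 1"
    (is "norm ?R > 1")
proof -
  define m where "m = real s - 1"
  define w where "w = (1 + \<i> * of_real x) ^ s"
  have m: "m > 0" and s_m: "real s = m + 1"
    using s by (auto simp: m_def)
  have "(norm w)\<^sup>2 = ((norm (1 + \<i> * of_real x))\<^sup>2) ^ s"
    by (simp add: w_def norm_power mult.commute flip: power_mult)
  then have norm_w: "(norm w)\<^sup>2 = (1 + x\<^sup>2) ^ s"
    by (simp add: cmod_power2)
  obtain k where k: "s = Suc k" "k \<ge> 1"
    using s by (cases s) auto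
  \<comment> \<open>One factor is split off since Bernoulli's inequality alone is not strict; the gain is \<open>k x\<^sup>4\<close>.\<close>
  have "1 + real s * x\<^sup>2 < (1 + x\<^sup>2) * (1 + real k * x\<^sup>2)"
    using k x by (simp add: field_simps)
  also have "\<dots> \<le> (1 + x\<^sup>2) * (1 + x\<^sup>2) ^ k"
    using Bernoulli_inequality[of "x\<^sup>2" k] order_trans[OF _ zero_le_power2, of "-1" x]
    by (intro mult_left_mono) auto
  finally have norm_gt: "1 + real s * x\<^sup>2 < (norm w)\<^sup>2"
    using norm_w k by simp
  have Re_ge: "1 - real s * m / 2 * x\<^sup>2 \<le> Re w"
    using one_plus_imaginary_power_bounds[of x s s] x small by (simp add: w_def m_def)
  have "m * (real s * x\<^sup>2) < m * ((norm w)\<^sup>2 - 1)"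
    using m norm_gt by simp
  then have pos: "0 < m * ((norm w)\<^sup>2 - 1) + 2 * (Re w - 1)"
    using Re_ge by (simp add: algebra_simps)
  have "(real s)\<^sup>2 * (norm ?R)\<^sup>2 = (norm (of_real (real s) * ?R))\<^sup>2"
    by (simp only: norm_mult norm_of_real power_mult_distrib power2_abs)
  also have "of_real (real s) * ?R = of_real m * w + 1"
    using s by (simp add: m_def w_def field_simps)
  also have "(norm (of_real m * w + 1))\<^sup>2 = m\<^sup>2 * (norm w)\<^sup>2 + 2 * m * Re w + 1"
    unfolding cmod_power2 by (simp add: power2_eq_square algebra_simps)
  also have "\<dots> = (real s)\<^sup>2 + m * (m * ((norm w)\<^sup>2 - 1) + 2 * (Re w - 1))"
    by (simp add: s_m power2_eq_square algebra_simps)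
  finally have "(real s)\<^sup>2 * 1 < (real s)\<^sup>2 * (norm ?R)\<^sup>2"
    using mult_pos_pos[OF m pos] by simp
  then have "1\<^sup>2 < (norm ?R)\<^sup>2"
    using s by (simp only: mult_less_cancel_left_pos zero_less_power) simp
  then show ?thesis
    by (rule power2_less_imp_less) simp
qed

section \<open>Bounded linear right-hand sides\<close>

lemma snorm_nonneg:
  assumes "semi_inner_product_space V ip" "u \<in> V"
  shows "0 \<le> snorm ip u"
  using assms by (simp add: semi_inner_product_space_def snorm_def)

lemma snorm_zero:
  assumes "semi_inner_product_space V ip"
  shows "snorm ip 0 = 0"
proof -
  have "0 \<in> V"
    using assms by (simp add: semi_inner_product_space_def subspace_0)
  then have "ip (0 *\<^sub>R 0) 0 = 0 * ip 0 0"
    using assms unfolding semi_inner_product_space_def by blast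
  then show ?thesis by (simp add: snorm_def)
qed

text \<open>
  The first derivative of \<open>g\<close> is \<open>g\<close> itself at every point and all higher ones vanish, so every
  Taylor remainder is exactly 0.
\<close>

lemma bounded_linear_imp_smooth:
  assumes sip: "semi_inner_product_space V ip"
    and g: "g \<in> V \<rightarrow> V"
    and lin: "\<And>a b x y. x \<in> V \<Longrightarrow> y \<in> V \<Longrightarrow> g (a *\<^sub>R x + b *\<^sub>R y) = a *\<^sub>R g x + b *\<^sub>R g y"
    and bound: "\<And>x. x \<in> V \<Longrightarrow> snorm ip (g x) \<le> C * snorm ip x"
  shows "smooth V ip g"
proof -
  define D :: "nat \<Rightarrow> 'a \<Rightarrow> 'a list \<Rightarrow> 'a" where
    "D k x vs = (if k = 0 then g x else if k = 1 then g (hd vs) else 0)" for k x vs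
  have zero: "0 \<in> V"
    using sip by (simp add: semi_inner_product_space_def subspace_0)
  have multilinear: "bounded_multilinear_on V ip k (D k x)" if "x \<in> V" for k x
  proof -
    consider "k = 0" | "k = 1" | "k \<ge> 2" by linarith
    then show ?thesis
    proof cases
      case 1
      then show ?thesis
        using g \<open>x \<in> V\<close> by (auto simp: bounded_multilinear_on_def D_def)
    next
      case 2
      show ?thesis
        unfolding bounded_multilinear_on_def
      proof (intro conjI exI[of _ C] allI impI; elim conjE)
        fix vs assume "set vs \<subseteq> V" "length vs = k"
        then obtain v where "vs = [v]" "v \<in> V"
          using 2 by (cases vs) auto
        then show "D k x vs \<in> V" "snorm ip (D k x vs) \<le> C * (\<Prod>v\<leftarrow>vs. snorm ip v)"
          using 2 g bound by (auto simp: D_def)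
      qed (use 2 lin in \<open>simp add: D_def\<close>)
    next
      case 3
      then show ?thesis
        using zero snorm_zero[OF sip]
        by (auto simp: bounded_multilinear_on_def D_def intro!: exI[of _ 0])
    qed
  qed
  have remainder: "D k (x + h) vs - D k x vs - D (Suc k) x (h # vs) = 0"
    if "x \<in> V" "h \<in> V" for k x h vs
    using lin[OF that, of 1 1] by (simp add: D_def)
  have rhs: "0 \<le> \<epsilon> * snorm ip h * (\<Prod>v\<leftarrow>vs. snorm ip v)"
    if "\<epsilon> > 0" "h \<in> V" "set vs \<subseteq> V" for \<epsilon> h vs
    using that snorm_nonneg[OF sip]
    by (intro mult_nonneg_nonneg prod_list_nonneg) (auto simp: less_imp_le)
  show ?thesis
    unfolding smooth_def
  proof (intro exI[of _ D] conjI allI ballI impI)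
    show "D 0 x [] = g x" for x by (simp add: D_def)
    show "bounded_multilinear_on V ip k (D k x)" if "x \<in> V" for k x
      using multilinear[OF that] .
    show "\<exists>\<delta>>0. \<forall>h\<in>V. snorm ip h < \<delta> \<longrightarrow> (\<forall>vs. set vs \<subseteq> V \<and> length vs = k \<longrightarrow>
              snorm ip (D k (x + h) vs - D k x vs - D (Suc k) x (h # vs))
                \<le> \<epsilon> * snorm ip h * (\<Prod>v\<leftarrow>vs. snorm ip v))"
      if "x \<in> V" "\<epsilon> > 0" for k x \<epsilon>
      using that remainder rhs snorm_zero[OF sip] by (intro exI[of _ 1]) simp
  qed
qed

lemma lipschitz_seminorm_le:
  assumes "semi_inner_product_space V ip" "L \<ge> 0"
    and lip: "\<And>u v. u \<in> V \<Longrightarrow> v \<in> V \<Longrightarrow> snorm ip (g u - g v) \<le> L * snorm ip (u - v)"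
  shows "lipschitz_seminorm V ip g \<le> ennreal L"
proof -
  have "ennreal (snorm ip (g u - g v)) / ennreal (snorm ip (u - v)) \<le> ennreal L"
    if "u \<in> V" "v \<in> V" for u v
  proof (cases "snorm ip (u - v) = 0")
    case True
    then have "ennreal (snorm ip (g u - g v)) = 0"
      using lip[OF that] by (simp add: ennreal_eq_0_iff)
    then show ?thesis by simp
  next
    case False
    have "u - v \<in> V"
      using assms(1) that by (simp add: semi_inner_product_space_def subspace_diff)
    then have "0 < snorm ip (u - v)"
      using snorm_nonneg[OF assms(1), of "u - v"] False by simp
    then have "ennreal (snorm ip (g u - g v)) \<le> ennreal (snorm ip (u - v)) * ennreal L"
      using lip[OF that] \<open>L \<ge> 0\<close> by (simp add: ennreal_leI mult.commute flip: ennreal_mult')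
    then show ?thesis
      using \<open>0 < snorm ip (u - v)\<close> by (intro divide_le_posI_ennreal) auto
  qed
  then show ?thesis
    unfolding lipschitz_seminorm_def by (auto intro!: SUP_least)
qed

section \<open>The Euclidean plane and the rotation field\<close>

text \<open>
  The plane is spanned by the generators 0 and 1; its points are named by complex numbers, so that
  rotations become multiplications.
\<close>

definition plane_point :: "complex \<Rightarrow> universe" where
  "plane_point z = Poly_Mapping.single 0 (Re z) + Poly_Mapping.single 1 (Im z)"

definition plane_coord :: "universe \<Rightarrow> complex" where
  "plane_coord u = Complex (Poly_Mapping.lookup u 0) (Poly_Mapping.lookup u 1)"

definition plane_inner :: "universe \<Rightarrow> universe \<Rightarrow> real" where
  "plane_inner u v = plane_coord u \<bullet> plane_coord v"

definition rotation_field :: "real \<Rightarrow> universe \<Rightarrow> universe" where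
  "rotation_field L u = plane_point (\<i> * of_real L * plane_coord u)"

lemma lookup_scaleR:
  "Poly_Mapping.lookup (c *\<^sub>R u) i = c *\<^sub>R Poly_Mapping.lookup u i"
proof -
  have "finite {i. c *\<^sub>R Poly_Mapping.lookup u i \<noteq> 0}"
    by (rule finite_subset[OF _ finite_lookup[of u]]) auto
  then show ?thesis
    by (simp add: scaleR_poly_mapping_def)
qed

lemma plane_coord_point [simp]: "plane_coord (plane_point z) = z"
  by (simp add: plane_coord_def plane_point_def lookup_add lookup_single complex_eq_iff)

lemma linear_plane_point: "linear plane_point"
  by (rule linearI; rule poly_mapping_eqI)
     (simp_all add: plane_point_def lookup_add lookup_scaleR lookup_single when_def algebra_simps)

lemma linear_plane_coord: "linear plane_coord"
  by (rule linearI) (simp_all add: plane_coord_def lookup_add lookup_scaleR complex_eq_iff)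

lemmas plane_point_simps =
  linear_add[OF linear_plane_point] linear_scale[OF linear_plane_point]

lemmas plane_coord_simps =
  linear_add[OF linear_plane_coord] linear_scale[OF linear_plane_coord]
  linear_diff[OF linear_plane_coord]

lemma snorm_plane_inner: "snorm plane_inner u = norm (plane_coord u)"
  by (simp add: snorm_def plane_inner_def norm_eq_sqrt_inner)

lemma semi_inner_product_space_plane: "semi_inner_product_space (range plane_point) plane_inner"
proof -
  have "subspace (range plane_point)"
    using linear_subspace_image[OF linear_plane_point] subspace_UNIV by blast
  then show ?thesis
    by (simp add: semi_inner_product_space_def plane_inner_def plane_coord_simps
        inner_add_left) (simp add: inner_commute)
qed

lemma rotation_field_linear:
  "rotation_field L (a *\<^sub>R u + b *\<^sub>R v) = a *\<^sub>R rotation_field L u + b *\<^sub>R rotation_field L v"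
  by (simp add: rotation_field_def plane_coord_simps distrib_left flip: plane_point_simps)

lemma snorm_rotation_field: "snorm plane_inner (rotation_field L u) = \<bar>L\<bar> * snorm plane_inner u"
  by (simp add: snorm_plane_inner rotation_field_def norm_mult)

lemma semibounded_rotation_field: "semibounded V plane_inner (rotation_field L)"
  by (simp add: semibounded_def plane_inner_def rotation_field_def inner_complex_def)

lemma ssprk2_stage_rotation_field:
  "ssprk2_stage s (rotation_field L) dt (plane_point z) k =
     plane_point ((1 + \<i> * of_real (dt * L / (real s - 1))) ^ k * z)"
proof (induction k)
  case (Suc k)
  then show ?case
    by (simp add: rotation_field_def scaleR_conv_of_real algebra_simps flip: plane_point_simps)
qed simp

lemma ssprk2_rotation_field:
  "ssprk2 s (rotation_field L) dt (plane_point z) =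
     plane_point ((of_real ((real s - 1) / real s) * (1 + \<i> * of_real (dt * L / (real s - 1))) ^ s
       + of_real (1 / real s)) * z)"
  unfolding ssprk2_def ssprk2_stage_rotation_field plane_point_simps[symmetric]
  by (simp only: scaleR_conv_of_real distrib_right mult.assoc)

lemma not_strongly_stable_rotation_field:
  assumes L: "L > 0" and s: "s \<ge> 2"
  shows "\<not> strongly_stable (range plane_point) plane_inner (ssprk2 s (rotation_field L))"
proof
  assume "strongly_stable (range plane_point) plane_inner (ssprk2 s (rotation_field L))"
  then obtain dt_max where "dt_max > 0"
    and stable: "\<And>u dt. u \<in> range plane_point \<Longrightarrow> 0 < dt \<Longrightarrow> dt \<le> dt_max \<Longrightarrow>
      (snorm plane_inner (ssprk2 s (rotation_field L) dt u))\<^sup>2 \<le> (snorm plane_inner u)\<^sup>2"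
    unfolding strongly_stable_def greaterThanAtMost_iff Ball_def by blast
  \<comment> \<open>The bound \<open>1 / s\<close> gives \<open>s (s - 1) / 2 x\<^sup>2 \<le> 1\<close>; the other one gives \<open>dt \<le> dt_max\<close>.\<close>
  define x where "x = min (dt_max * L / (real s - 1)) (1 / real s)"
  define dt where "dt = x * (real s - 1) / L"
  have x: "x > 0" "x \<le> 1 / real s" "x \<le> dt_max * L / (real s - 1)"
    using L s \<open>dt_max > 0\<close> by (auto simp: x_def)
  have dt: "0 < dt" "dt \<le> dt_max"
    using x L s by (auto simp: dt_def field_simps)
  have "real s * (real s - 1) / 2 * x\<^sup>2 \<le> (real s)\<^sup>2 * (1 / real s)\<^sup>2"
    using x s by (intro mult_mono power_mono) (auto simp: power2_eq_square field_simps)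
  also have "\<dots> = 1"
    using s by (simp add: power_divide)
  finally have small: "real s * (real s - 1) / 2 * x\<^sup>2 \<le> 1" .
  have "dt * L / (real s - 1) = x"
    using L s by (simp add: dt_def)
  then have "snorm plane_inner (ssprk2 s (rotation_field L) dt (plane_point 1)) > 1"
    using norm_stability_polynomial_gt_1[OF s x(1) small]
    by (simp add: snorm_plane_inner ssprk2_rotation_field)
  then have "(snorm plane_inner (ssprk2 s (rotation_field L) dt (plane_point 1)))\<^sup>2 > 1"
    by (rule one_less_power) simp
  moreover have "snorm plane_inner (plane_point 1) = 1"
    by (simp add: snorm_plane_inner)
  ultimately show False
    using stable[of "plane_point 1" dt] dt by simp
qed

theorem theorem4p1:
  fixes L :: real and s :: nat
  assumes "L > 0" and "s \<ge> 2"
  shows "\<exists>(V :: universe set) (ip :: universe \<Rightarrow> universe \<Rightarrow> real) (g :: universe \<Rightarrow> universe).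
           semi_inner_product_space V ip \<and> g \<in> V \<rightarrow> V \<and>
           smooth V ip g \<and> semibounded V ip g \<and> lipschitz_seminorm V ip g \<le> ennreal L \<and>
           \<not> strongly_stable V ip (ssprk2 s g)"
proof (intro exI conjI)
  let ?V = "range plane_point" and ?g = "rotation_field L"
  show sip: "semi_inner_product_space ?V plane_inner"
    by (rule semi_inner_product_space_plane)
  show maps: "?g \<in> ?V \<rightarrow> ?V"
    by (simp add: rotation_field_def)
  show "smooth ?V plane_inner ?g"
    by (rule bounded_linear_imp_smooth[OF sip maps rotation_field_linear, of "\<bar>L\<bar>"])
       (simp add: snorm_rotation_field)
  show "semibounded ?V plane_inner ?g"
    by (rule semibounded_rotation_field)
  have "?g u - ?g v = ?g (u - v)" for u v
    using rotation_field_linear[of L 1 u "-1" v] by simp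
  then show "lipschitz_seminorm ?V plane_inner ?g \<le> ennreal L"
    using \<open>L > 0\<close> by (intro lipschitz_seminorm_le[OF sip]) (simp_all add: snorm_rotation_field)
  show "\<not> strongly_stable ?V plane_inner (ssprk2 s ?g)"
    using assms by (rule not_strongly_stable_rotation_field)
qed

end
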